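(* Given any finitely generated $\mathcal{C}^{\infty}$-ring $(A, \Phi)$, let $\mathrm{Cong}(A,\Phi)$ denote the set of all $\mathcal{C}^{\infty}$-congruences in $A$ and let $\mathfrak{I}(A,\Phi)$ denote the set of all ideals of $A$. The map $$\psi_A: \mathrm{Cong}(A,\Phi) \rightarrow \mathfrak{I}(A, \Phi),\quad R \mapsto \{ x \in A \mid (x,0) \in R \}$$ is a bijection, whose inverse is given by $$\varphi_A: \mathfrak{I}(A, \Phi) \rightarrow \mathrm{Cong}(A, \Phi),\quad I \mapsto \{ (x,y) \in A\times A \mid x - y \in I \}.$$
   Context: $\mathbb{N}=\{0,1,2,\dots\}$. A $\mathcal{C}^{\infty}$-structure is a pair $(A,\Phi)$, where $A$ is a set and $\Phi$ assigns to each $n\in\mathbb{N}$ and each smooth function $f\in\mathcal{C}^{\infty}(\mathbb{R}^n,\mathbb{R})$ a function $\Phi(f):A^n\to A$. It is a $\mathcal{C}^{\infty}$-ring if (1) for each $n$ and $k\le n$, the projection $p_k:\mathbb{R}^n\to\mathbb{R}$ onto the $k$-th coordinate is sent to the projection $\pi_k:A^n\to A$ onto the $k$-th coordinate; and (2) whenever $f\in\mathcal{C}^{\infty}(\mathbb{R}^n,\mathbb{R})$, $g_1,\dots,g_n,h\in\mathcal{C}^{\infty}(\mathbb{R}^k,\mathbb{R})$ and $h=f\circ(g_1,\dots,g_n)$, then $\Phi(h)=\Phi(f)\circ(\Phi(g_1),\dots,\Phi(g_n))$. Any $\mathcal{C}^{\infty}$-ring $(A,\Phi)$ is regarded as a commutative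 unital ring with operations $\Phi(+),\Phi(\cdot),\Phi(-)$ and constants $0=\Phi(0)$, $1=\Phi(1)$; an ideal of $(A,\Phi)$ means an ideal of this commutative ring. A $\mathcal{C}^{\infty}$-congruence on $(A,\Phi)$ is an equivalence relation $R\subseteq A\times A$ such that for all $n$, $f\in\mathcal{C}^{\infty}(\mathbb{R}^n,\mathbb{R})$ and $(x_1,y_1),\dots,(x_n,y_n)\in R$ one has $(\Phi(f)(x_1,\dots,x_n),\Phi(f)(y_1,\dots,y_n))\in R$. $(A,\Phi)$ is finitely generated if there is a finite $X\subseteq A$ such that the only subset of $A$ containing $X$ and closed under all $\Phi(f)$ is $A$ itself. *)

theory Defs
  imports "HOL-Analysis.Analysis" "HOL-Algebra.Ideal"
begin

text \<open>
  The power \<open>A\<^sup>n\<close> of a set \<open>A\<close> is \<open>{..<n} \<rightarrow>\<^sub>E A\<close>; coordinates are thus numbered from \<open>0\<close>.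
  In particular, \<open>\<real>\<^sup>n\<close> is \<open>Rn n\<close>, the carrier of the product topology \<open>powertop_real {..<n}\<close>.
\<close>

abbreviation Rn :: "nat \<Rightarrow> (nat \<Rightarrow> real) set" where
  "Rn n \<equiv> {..<n} \<rightarrow>\<^sub>E UNIV"

definition tup :: "'a list \<Rightarrow> nat \<Rightarrow> 'a" where
  "tup xs = (\<lambda>i\<in>{..<length xs}. xs ! i)"

definition partial :: "nat \<Rightarrow> ((nat \<Rightarrow> real) \<Rightarrow> real) \<Rightarrow> (nat \<Rightarrow> real) \<Rightarrow> real" where
  "partial i f x = deriv (\<lambda>t. f (x(i := t))) (x i)"

text \<open>
  \<open>f\<close> is smooth on \<open>\<real>\<^sup>n\<close> iff its iterated partial derivatives of all orders (including order \<open>0\<close>)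
  exist and are continuous. As \<open>deriv\<close> is total, existence of the next partial derivative is
  demanded explicitly.
\<close>

definition smooth_on_Rn :: "nat \<Rightarrow> ((nat \<Rightarrow> real) \<Rightarrow> real) \<Rightarrow> bool" where
  "smooth_on_Rn n f \<longleftrightarrow>
     (\<forall>is. set is \<subseteq> {..<n} \<longrightarrow>
        continuous_map (powertop_real {..<n}) euclideanreal (foldr partial is f) \<and>
        (\<forall>i<n. \<forall>x\<in>Rn n. (\<lambda>t. foldr partial is f (x(i := t))) differentiable (at (x i))))"

text \<open>
  Elements of \<open>C\<^sup>\<infinity>(\<real>\<^sup>n, \<real>)\<close> are represented by functions that are \<open>undefined\<close> outside of \<open>\<real>\<^sup>n\<close>, so
  that equality in \<open>Cinf n\<close> is equality of functions on \<open>\<real>\<^sup>n\<close>.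
\<close>

definition Cinf :: "nat \<Rightarrow> ((nat \<Rightarrow> real) \<Rightarrow> real) set" where
  "Cinf n = {f \<in> Rn n \<rightarrow>\<^sub>E UNIV. smooth_on_Rn n f}"

type_synonym 'a cinf_interp = "nat \<Rightarrow> ((nat \<Rightarrow> real) \<Rightarrow> real) \<Rightarrow> (nat \<Rightarrow> 'a) \<Rightarrow> 'a"

locale cinf_structure =
  fixes A :: "'a set" and \<Phi> :: "'a cinf_interp"
  assumes Phi_closed: "f \<in> Cinf n \<Longrightarrow> \<Phi> n f \<in> ({..<n} \<rightarrow>\<^sub>E A) \<rightarrow> A"

locale cinf_ring = cinf_structure +
  assumes Phi_proj: "k < n \<Longrightarrow> a \<in> {..<n} \<rightarrow>\<^sub>E A \<Longrightarrow> \<Phi> n (\<lambda>x\<in>Rn n. x k) a = a k"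
    and Phi_comp: "f \<in> Cinf n \<Longrightarrow> (\<And>i. i < n \<Longrightarrow> g i \<in> Cinf k) \<Longrightarrow> h \<in> Cinf k \<Longrightarrow>
      (\<And>x. x \<in> Rn k \<Longrightarrow> h x = f (\<lambda>i\<in>{..<n}. g i x)) \<Longrightarrow> a \<in> {..<k} \<rightarrow>\<^sub>E A \<Longrightarrow>
      \<Phi> k h a = \<Phi> n f (\<lambda>i\<in>{..<n}. \<Phi> k (g i) a)"

definition underlying_ring :: "'a set \<Rightarrow> 'a cinf_interp \<Rightarrow> 'a ring" where
  "underlying_ring A \<Phi> = \<lparr>
     carrier = A,
     mult = (\<lambda>x y. \<Phi> 2 (\<lambda>v\<in>Rn 2. v 0 * v 1) (tup [x, y])),
     one = \<Phi> 0 (\<lambda>v\<in>Rn 0. 1) (tup []),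
     zero = \<Phi> 0 (\<lambda>v\<in>Rn 0. 0) (tup []),
     add = (\<lambda>x y. \<Phi> 2 (\<lambda>v\<in>Rn 2. v 0 + v 1) (tup [x, y]))\<rparr>"

definition finitely_generated :: "'a set \<Rightarrow> 'a cinf_interp \<Rightarrow> bool" where
  "finitely_generated A \<Phi> \<longleftrightarrow>
     (\<exists>X\<subseteq>A. finite X \<and>
        (\<forall>B\<subseteq>A. X \<subseteq> B \<and> (\<forall>n. \<forall>f\<in>Cinf n. \<Phi> n f \<in> ({..<n} \<rightarrow>\<^sub>E B) \<rightarrow> B) \<longrightarrow> B = A))"

definition cinf_congruence :: "'a set \<Rightarrow> 'a cinf_interp \<Rightarrow> ('a \<times> 'a) set \<Rightarrow> bool" where
  "cinf_congruence A \<Phi> R \<longleftrightarrow> equiv A R \<and>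
     (\<forall>n. \<forall>f\<in>Cinf n. \<forall>x\<in>{..<n} \<rightarrow>\<^sub>E A. \<forall>y\<in>{..<n} \<rightarrow>\<^sub>E A.
        (\<forall>i<n. (x i, y i) \<in> R) \<longrightarrow> (\<Phi> n f x, \<Phi> n f y) \<in> R)"

definition Cong :: "'a set \<Rightarrow> 'a cinf_interp \<Rightarrow> ('a \<times> 'a) set set" where
  "Cong A \<Phi> = {R. cinf_congruence A \<Phi> R}"

definition Ideals :: "'a set \<Rightarrow> 'a cinf_interp \<Rightarrow> 'a set set" where
  "Ideals A \<Phi> = {I. ideal I (underlying_ring A \<Phi>)}"

definition psi :: "'a set \<Rightarrow> 'a cinf_interp \<Rightarrow> ('a \<times> 'a) set \<Rightarrow> 'a set" where
  "psi A \<Phi> R = {x \<in> A. (x, \<zero>\<^bsub>underlying_ring A \<Phi>\<^esub>) \<in> R}"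

text \<open>
  Subtraction is that of the ring; the operation \<open>\<Phi>(-)\<close> is shown below to be its negation
  (lemma \<open>a_inv_underlying_ring\<close>).
\<close>

definition phi :: "'a set \<Rightarrow> 'a cinf_interp \<Rightarrow> 'a set \<Rightarrow> ('a \<times> 'a) set" where
  "phi A \<Phi> I = {(x, y) \<in> A \<times> A. x \<ominus>\<^bsub>underlying_ring A \<Phi>\<^esub> y \<in> I}"


subsection \<open>The underlying ring is a commutative ring\<close>

inductive polyfun :: "nat \<Rightarrow> ((nat \<Rightarrow> real) \<Rightarrow> real) \<Rightarrow> bool" for n where
  const: "polyfun n (\<lambda>x. c)"
| coord: "i < n \<Longrightarrow> polyfun n (\<lambda>x. x i)"
| add: "polyfun n f \<Longrightarrow> polyfun n g \<Longrightarrow> polyfun n (\<lambda>x. f x + g x)"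
| mult: "polyfun n f \<Longrightarrow> polyfun n g \<Longrightarrow> polyfun n (\<lambda>x. f x * g x)"

lemma polyfun_uminus: "polyfun n f \<Longrightarrow> polyfun n (\<lambda>x. - f x)"
  using polyfun.mult[OF polyfun.const[of n "-1"]] by simp

lemma polyfun_differentiable:
  "polyfun n f \<Longrightarrow> (\<lambda>t. f (x(i := t))) field_differentiable (at s)"
proof (induction rule: polyfun.induct)
  case (coord j)
  then show ?case by (cases "i = j") auto
qed (auto intro: field_differentiable_add field_differentiable_mult)

lemma polyfun_partial: "polyfun n f \<Longrightarrow> polyfun n (partial i f)"
proof (induction rule: polyfun.induct)
  case (const c)
  then show ?case by (simp add: partial_def[abs_def] polyfun.const)
next
  case (coord j)
  then show ?case by (cases "i = j") (auto simp: partial_def[abs_def] polyfun.const)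
next
  case (add f g)
  then have "partial i (\<lambda>x. f x + g x) = (\<lambda>x. partial i f x + partial i g x)"
    by (simp add: partial_def[abs_def] polyfun_differentiable)
  with add show ?case by (simp add: polyfun.add)
next
  case (mult f g)
  then have "partial i (\<lambda>x. f x * g x) = (\<lambda>x. f x * partial i g x + partial i f x * g x)"
    by (simp add: partial_def[abs_def] polyfun_differentiable)
  with mult show ?case by (simp add: polyfun.add polyfun.mult)
qed

lemma polyfun_foldr_partial: "polyfun n f \<Longrightarrow> polyfun n (foldr partial is f)"
  by (induction "is") (auto intro: polyfun_partial)

lemma polyfun_continuous:
  "polyfun n f \<Longrightarrow> continuous_map (powertop_real {..<n}) euclideanreal f"
  by (induction rule: polyfun.induct)
    (auto intro!: continuous_map_add continuous_map_real_mult continuous_map_product_projection)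

lemma fun_upd_Rn: "x \<in> Rn n \<Longrightarrow> i < n \<Longrightarrow> x(i := t) \<in> Rn n"
  by (auto simp: PiE_iff extensional_def)

lemma foldr_partial_cong:
  assumes "\<And>x. x \<in> Rn n \<Longrightarrow> f x = g x" "set is \<subseteq> {..<n}" "x \<in> Rn n"
  shows "foldr partial is f x = foldr partial is g x"
  using assms(2,3)
proof (induction "is" arbitrary: x)
  case Nil
  then show ?case using assms(1) by simp
next
  case (Cons i "is")
  then have "foldr partial is f (x(i := t)) = foldr partial is g (x(i := t))" for t
    by (intro Cons.IH fun_upd_Rn) auto
  then show ?case by (simp only: foldr.simps comp_apply partial_def[of i])
qed

lemma smooth_on_Rn_cong:
  assumes "\<And>x. x \<in> Rn n \<Longrightarrow> f x = g x" "smooth_on_Rn n f"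
  shows "smooth_on_Rn n g"
  unfolding smooth_on_Rn_def
proof (intro allI impI conjI ballI)
  fix "is" assume is_n: "set is \<subseteq> {..<n}"
  note eq = foldr_partial_cong[of n f g "is", OF assms(1) is_n]
  show "continuous_map (powertop_real {..<n}) euclideanreal (foldr partial is g)"
  proof (rule continuous_map_eq)
    show "continuous_map (powertop_real {..<n}) euclideanreal (foldr partial is f)"
      using assms(2) is_n by (simp add: smooth_on_Rn_def)
  qed (use eq in simp)
  fix i x assume "i < n" "x \<in> Rn n"
  then have "(\<lambda>t. foldr partial is f (x(i := t))) = (\<lambda>t. foldr partial is g (x(i := t)))"
    by (intro ext eq fun_upd_Rn)
  moreover have "(\<lambda>t. foldr partial is f (x(i := t))) differentiable (at (x i))"
    using assms(2) is_n \<open>i < n\<close> \<open>x \<in> Rn n\<close> by (simp only: smooth_on_Rn_def)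
  ultimately show "(\<lambda>t. foldr partial is g (x(i := t))) differentiable (at (x i))"
    by (simp only:)
qed

lemma polyfun_Cinf:
  assumes "polyfun n f"
  shows "restrict f (Rn n) \<in> Cinf n"
proof -
  have "smooth_on_Rn n f"
    using assms by (auto simp: smooth_on_Rn_def intro: polyfun_continuous polyfun_foldr_partial
        polyfun_differentiable field_differentiable_imp_differentiable)
  then have "smooth_on_Rn n (restrict f (Rn n))"
    by (rule smooth_on_Rn_cong[rotated]) auto
  then show ?thesis by (auto simp: Cinf_def)
qed

lemma tup_PiE: "set xs \<subseteq> A \<Longrightarrow> n = length xs \<Longrightarrow> tup xs \<in> {..<n} \<rightarrow>\<^sub>E A"
  by (auto simp: tup_def subset_iff)

lemma tup_nth: "i < length xs \<Longrightarrow> tup xs i = xs ! i"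
  by (simp add: tup_def)

context cinf_ring
begin

definition ev :: "nat \<Rightarrow> ((nat \<Rightarrow> real) \<Rightarrow> real) \<Rightarrow> (nat \<Rightarrow> 'a) \<Rightarrow> 'a" where
  "ev k f = \<Phi> k (restrict f (Rn k))"

lemma ev_closed: "polyfun k f \<Longrightarrow> a \<in> {..<k} \<rightarrow>\<^sub>E A \<Longrightarrow> ev k f a \<in> A"
  unfolding ev_def using Phi_closed[OF polyfun_Cinf] by blast

lemma ev_coord: "i < k \<Longrightarrow> a \<in> {..<k} \<rightarrow>\<^sub>E A \<Longrightarrow> ev k (\<lambda>x. x i) a = a i"
  by (simp add: ev_def Phi_proj)

lemma ev_comp:
  assumes "polyfun n f" "list_all (polyfun k) gs" "length gs = n"
    "polyfun k (\<lambda>x. f (tup (map (\<lambda>g. g x) gs)))" "a \<in> {..<k} \<rightarrow>\<^sub>E A"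
  shows "ev k (\<lambda>x. f (tup (map (\<lambda>g. g x) gs))) a = ev n f (tup (map (\<lambda>g. ev k g a) gs))"
proof -
  have "ev k (\<lambda>x. f (tup (map (\<lambda>g. g x) gs))) a =
      \<Phi> n (restrict f (Rn n)) (\<lambda>i\<in>{..<n}. \<Phi> k (restrict (gs ! i) (Rn k)) a)"
    unfolding ev_def
  proof (rule Phi_comp)
    fix x assume x: "x \<in> Rn k"
    have "(\<lambda>i\<in>{..<n}. restrict (gs ! i) (Rn k) x) = tup (map (\<lambda>g. g x) gs)"
      using x assms(3) by (auto simp: tup_def fun_eq_iff)
    moreover have "tup (map (\<lambda>g. g x) gs) \<in> Rn n"
      by (rule tup_PiE) (use assms(3) in auto)
    ultimately show "restrict (\<lambda>x. f (tup (map (\<lambda>g. g x) gs))) (Rn k) x =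
        restrict f (Rn n) (\<lambda>i\<in>{..<n}. restrict (gs ! i) (Rn k) x)"
      using x by simp
  qed (use assms in \<open>auto intro!: polyfun_Cinf simp: list_all_length\<close>)
  also have "(\<lambda>i\<in>{..<n}. \<Phi> k (restrict (gs ! i) (Rn k)) a) = tup (map (\<lambda>g. ev k g a) gs)"
    using assms(3) by (auto simp: tup_def ev_def fun_eq_iff)
  finally show ?thesis by (simp only: ev_def[of n])
qed

abbreviation "U \<equiv> underlying_ring A \<Phi>"

lemma U_simps:
  "carrier U = A"
  "x \<oplus>\<^bsub>U\<^esub> y = ev 2 (\<lambda>v. v 0 + v 1) (tup [x, y])"
  "x \<otimes>\<^bsub>U\<^esub> y = ev 2 (\<lambda>v. v 0 * v 1) (tup [x, y])"
  "\<zero>\<^bsub>U\<^esub> = ev 0 (\<lambda>v. 0) (tup [])"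
  "\<one>\<^bsub>U\<^esub> = ev 0 (\<lambda>v. 1) (tup [])"
  by (simp_all add: underlying_ring_def ev_def)

lemma ev_add:
  assumes "polyfun k f" "polyfun k g" "a \<in> {..<k} \<rightarrow>\<^sub>E A"
  shows "ev k (\<lambda>x. f x + g x) a = ev k f a \<oplus>\<^bsub>U\<^esub> ev k g a"
proof -
  have "polyfun 2 (\<lambda>v. v 0 + v 1)" by (intro polyfun.add polyfun.coord) auto
  from ev_comp[OF this, of k "[f, g]" a] assms show ?thesis
    by (simp add: tup_nth U_simps(2) polyfun.add)
qed

lemma ev_mult:
  assumes "polyfun k f" "polyfun k g" "a \<in> {..<k} \<rightarrow>\<^sub>E A"
  shows "ev k (\<lambda>x. f x * g x) a = ev k f a \<otimes>\<^bsub>U\<^esub> ev k g a"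
proof -
  have "polyfun 2 (\<lambda>v. v 0 * v 1)" by (intro polyfun.mult polyfun.coord) auto
  from ev_comp[OF this, of k "[f, g]" a] assms show ?thesis
    by (simp add: tup_nth U_simps(3) polyfun.mult)
qed

lemma ev_const: "a \<in> {..<k} \<rightarrow>\<^sub>E A \<Longrightarrow> ev k (\<lambda>x. c) a = ev 0 (\<lambda>v. c) (tup [])"
  using ev_comp[OF polyfun.const[of 0 c], of k "[]" a] by (simp add: polyfun.const)

lemma U_closed [simp]:
  "\<zero>\<^bsub>U\<^esub> \<in> A" "\<one>\<^bsub>U\<^esub> \<in> A"
  "x \<in> A \<Longrightarrow> y \<in> A \<Longrightarrow> x \<oplus>\<^bsub>U\<^esub> y \<in> A" "x \<in> A \<Longrightarrow> y \<in> A \<Longrightarrow> x \<otimes>\<^bsub>U\<^esub> y \<in> A"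
  unfolding U_simps by (auto intro!: ev_closed polyfun.intros tup_PiE)

lemmas ev_simps = ev_add ev_mult ev_coord ev_const[of _ _ 0, folded U_simps(4)]
  ev_const[of _ _ 1, folded U_simps(5)] tup_nth tup_PiE polyfun.intros

lemma U_uminus:
  assumes "x \<in> A"
  shows "ev 1 (\<lambda>v. - v 0) (tup [x]) \<in> A"
    and "ev 1 (\<lambda>v. - v 0) (tup [x]) \<oplus>\<^bsub>U\<^esub> x = \<zero>\<^bsub>U\<^esub>"
proof -
  have t: "tup [x] \<in> {..<1} \<rightarrow>\<^sub>E A" using assms by (intro tup_PiE) auto
  have p: "polyfun 1 (\<lambda>v. v 0)" by (rule polyfun.coord) simp
  show "ev 1 (\<lambda>v. - v 0) (tup [x]) \<in> A"
    by (rule ev_closed[OF polyfun_uminus[OF p] t])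
  show "ev 1 (\<lambda>v. - v 0) (tup [x]) \<oplus>\<^bsub>U\<^esub> x = \<zero>\<^bsub>U\<^esub>"
    using ev_add[OF polyfun_uminus[OF p] p t] ev_const[OF t, of 0] ev_coord[OF _ t, of 0]
    by (simp add: tup_nth U_simps)
qed

lemma cring_underlying_ring: "cring U"
proof (rule cringI)
  have assoc_add: "(x \<oplus>\<^bsub>U\<^esub> y) \<oplus>\<^bsub>U\<^esub> z = x \<oplus>\<^bsub>U\<^esub> (y \<oplus>\<^bsub>U\<^esub> z)"
    and assoc_mult: "(x \<otimes>\<^bsub>U\<^esub> y) \<otimes>\<^bsub>U\<^esub> z = x \<otimes>\<^bsub>U\<^esub> (y \<otimes>\<^bsub>U\<^esub> z)"
    and distr: "(x \<oplus>\<^bsub>U\<^esub> y) \<otimes>\<^bsub>U\<^esub> z = x \<otimes>\<^bsub>U\<^esub> z \<oplus>\<^bsub>U\<^esub> y \<otimes>\<^bsub>U\<^esub> z"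
    if "x \<in> A" "y \<in> A" "z \<in> A" for x y z
  proof -
    let ?a = "tup [x, y, z]"
    have "ev 3 (\<lambda>v. (v 0 + v 1) + v 2) ?a = ev 3 (\<lambda>v. v 0 + (v 1 + v 2)) ?a"
      by (simp add: add.assoc)
    then show "(x \<oplus>\<^bsub>U\<^esub> y) \<oplus>\<^bsub>U\<^esub> z = x \<oplus>\<^bsub>U\<^esub> (y \<oplus>\<^bsub>U\<^esub> z)"
      using that by (simp add: ev_simps)
    have "ev 3 (\<lambda>v. (v 0 * v 1) * v 2) ?a = ev 3 (\<lambda>v. v 0 * (v 1 * v 2)) ?a"
      by (simp add: mult.assoc)
    then show "(x \<otimes>\<^bsub>U\<^esub> y) \<otimes>\<^bsub>U\<^esub> z = x \<otimes>\<^bsub>U\<^esub> (y \<otimes>\<^bsub>U\<^esub> z)"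
      using that by (simp add: ev_simps)
    have "ev 3 (\<lambda>v. (v 0 + v 1) * v 2) ?a = ev 3 (\<lambda>v. v 0 * v 2 + v 1 * v 2) ?a"
      by (simp add: distrib_right)
    then show "(x \<oplus>\<^bsub>U\<^esub> y) \<otimes>\<^bsub>U\<^esub> z = x \<otimes>\<^bsub>U\<^esub> z \<oplus>\<^bsub>U\<^esub> y \<otimes>\<^bsub>U\<^esub> z"
      using that by (simp add: ev_simps)
  qed
  have comm_add: "x \<oplus>\<^bsub>U\<^esub> y = y \<oplus>\<^bsub>U\<^esub> x" and comm_mult: "x \<otimes>\<^bsub>U\<^esub> y = y \<otimes>\<^bsub>U\<^esub> x"
    if "x \<in> A" "y \<in> A" for x y
  proof -
    let ?a = "tup [x, y]"
    have "ev 2 (\<lambda>v. v 0 + v 1) ?a = ev 2 (\<lambda>v. v 1 + v 0) ?a"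
      by (simp add: add.commute)
    then show "x \<oplus>\<^bsub>U\<^esub> y = y \<oplus>\<^bsub>U\<^esub> x" using that by (simp add: ev_simps)
    have "ev 2 (\<lambda>v. v 0 * v 1) ?a = ev 2 (\<lambda>v. v 1 * v 0) ?a"
      by (simp add: mult.commute)
    then show "x \<otimes>\<^bsub>U\<^esub> y = y \<otimes>\<^bsub>U\<^esub> x" using that by (simp add: ev_simps)
  qed
  have zero: "\<zero>\<^bsub>U\<^esub> \<oplus>\<^bsub>U\<^esub> x = x" and one: "\<one>\<^bsub>U\<^esub> \<otimes>\<^bsub>U\<^esub> x = x" if "x \<in> A" for x
  proof -
    let ?a = "tup [x]"
    have t: "?a \<in> {..<1} \<rightarrow>\<^sub>E A" using that by (intro tup_PiE) auto
    have p: "polyfun 1 (\<lambda>v. v 0)" by (rule polyfun.coord) simp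
    show "\<zero>\<^bsub>U\<^esub> \<oplus>\<^bsub>U\<^esub> x = x"
      using ev_add[OF polyfun.const[of _ 0] p t] ev_const[OF t, of 0] ev_coord[OF _ t, of 0]
      by (simp add: tup_nth U_simps)
    show "\<one>\<^bsub>U\<^esub> \<otimes>\<^bsub>U\<^esub> x = x"
      using ev_mult[OF polyfun.const[of _ 1] p t] ev_const[OF t, of 1] ev_coord[OF _ t, of 0]
      by (simp add: tup_nth U_simps)
  qed
  have "\<exists>y\<in>A. y \<oplus>\<^bsub>U\<^esub> x = \<zero>\<^bsub>U\<^esub>" if "x \<in> A" for x
    using U_uminus[OF that] by blast
  then show "abelian_group U"
    by (intro abelian_groupI) (use assoc_add comm_add zero in \<open>simp_all add: U_simps(1)\<close>)
  show "comm_monoid U"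
    by (rule comm_monoidI) (use assoc_mult comm_mult one in \<open>auto simp: U_simps(1)\<close>)
  show "(x \<oplus>\<^bsub>U\<^esub> y) \<otimes>\<^bsub>U\<^esub> z = x \<otimes>\<^bsub>U\<^esub> z \<oplus>\<^bsub>U\<^esub> y \<otimes>\<^bsub>U\<^esub> z"
    if "x \<in> carrier U" "y \<in> carrier U" "z \<in> carrier U" for x y z
    using that distr by (simp add: U_simps(1))
qed

lemma a_inv_underlying_ring:
  assumes "x \<in> A"
  shows "\<ominus>\<^bsub>U\<^esub> x = \<Phi> 1 (\<lambda>v\<in>Rn 1. - v 0) (tup [x])"
proof -
  interpret cring U by (rule cring_underlying_ring)
  show ?thesis
    using minus_equality[of "ev 1 (\<lambda>v. - v 0) (tup [x])" x] U_uminus[OF assms] assms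
    by (simp add: U_simps(1) ev_def)
qed

end

end

theory Submission
  imports Defs
begin

text \<open>
  The only point that is not formal is that \<open>phi I\<close> respects every smooth \<open>f\<close>. By transitivity it
  suffices to change one coordinate at a time, from \<open>a\<^sub>i\<close> to \<open>c\<close>. Hadamard's lemma in the \<open>i\<close>-th
  variable, with the new value as an additional last variable \<open>x\<^sub>n\<close>, is the identity
  \<open>f(x with x\<^sub>n at i) = f(x) + (x\<^sub>n - x\<^sub>i) * g(x, x\<^sub>n)\<close> of smooth functions on \<open>\<real>\<^bsup>n+1\<^esup>\<close>; applying \<open>\<Phi>\<close> gives
  \<open>\<Phi>(f)(a with c at i) - \<Phi>(f)(a) = (c - a\<^sub>i) * b\<close> with \<open>b \<in> A\<close>, which lies in \<open>I\<close> if \<open>c - a\<^sub>i\<close> does.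
\<close>

section \<open>Segments in one coordinate direction and integrals along them\<close>

text \<open>For \<open>x\<close> in R^(n+1) and \<open>i < n\<close> this runs along a segment in
  R^n: at \<open>s = 0\<close> it is \<open>x\<close> without its last coordinate, at
  \<open>s = 1\<close> that last coordinate \<open>x n\<close> has replaced \<open>x i\<close>. The
  restriction puts the value in \<open>Rn n\<close> for every \<open>x\<close>, so the calculus
  below carries no side condition on \<open>x\<close>.\<close>

definition seg_point :: "nat \<Rightarrow> nat \<Rightarrow> real \<Rightarrow> (nat \<Rightarrow> real) \<Rightarrow> nat \<Rightarrow> real" where
  "seg_point n i s x = (\<lambda>k\<in>{..<n}. if k = i then x i + s * (x n - x i) else x k)"

text \<open>
  With the weight \<open>p\<close> and the path \<open>q\<close> as parameters, these functions are closed under partial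
  derivatives, so that their smoothness needs neither a chain rule in several variables nor the
  symmetry of partial derivatives. All three functions in Hadamard's lemma are of this form:
  \<open>q = 0\<close> and \<open>q = 1\<close> give the two values of \<open>f\<close>, and \<open>q(t) = t\<close> gives the quotient.
\<close>

definition seg_int ::
    "nat \<Rightarrow> nat \<Rightarrow> (real \<Rightarrow> real) \<Rightarrow> (real \<Rightarrow> real) \<Rightarrow> ((nat \<Rightarrow> real) \<Rightarrow> real) \<Rightarrow> (nat \<Rightarrow> real) \<Rightarrow> real" where
  "seg_int n i p q h x = integral {0..1} (\<lambda>t. p t * h (seg_point n i (q t) x))"

lemma seg_point_Rn: "seg_point n i s x \<in> Rn n"
  by (simp add: seg_point_def)

lemma smooth_continuous:
  "smooth_on_Rn n f \<Longrightarrow> continuous_map (powertop_real {..<n}) euclideanreal f"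
  unfolding smooth_on_Rn_def by (metis empty_subsetI empty_set foldr_Nil id_apply)

lemma smooth_partial:
  assumes "smooth_on_Rn n f" "i < n"
  shows "smooth_on_Rn n (partial i f)"
  unfolding smooth_on_Rn_def
proof (intro allI impI)
  fix "is" assume "set is \<subseteq> {..<n}"
  \<comment> \<open>\<open>foldr\<close> applies the last entry of a list first, so appending
    \<open>i\<close> means differentiating in direction \<open>i\<close> before all others.\<close>
  then have "set (is @ [i]) \<subseteq> {..<n}" using assms(2) by simp
  then show "continuous_map (powertop_real {..<n}) euclideanreal (foldr partial is (partial i f)) \<and>
    (\<forall>j<n. \<forall>x\<in>Rn n. (\<lambda>t. foldr partial is (partial i f) (x(j := t))) differentiable at (x j))"
    using assms(1)[unfolded smooth_on_Rn_def, rule_format, of "is @ [i]"] by simp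
qed

lemma smooth_has_partial:
  assumes "smooth_on_Rn n f" "i < n" "x \<in> Rn n"
  shows "((\<lambda>t. f (x(i := t))) has_real_derivative partial i f (x(i := s))) (at s)"
proof -
  \<comment> \<open>Smoothness gives differentiability only at the base point's own coordinate;
    moving the base point to \<open>x(i := s)\<close> gives it at every \<open>s\<close>.\<close>
  have "x(i := s) \<in> Rn n" using assms by (intro fun_upd_Rn)
  then have "(\<lambda>t. f (x(i := t))) differentiable (at s)"
    using assms(1)[unfolded smooth_on_Rn_def, rule_format, of "[]"] assms(2)
    by (auto dest!: bspec[of _ _ "x(i := s)"])
  then show ?thesis
    by (simp add: partial_def real_differentiable_def DERIV_deriv_iff_real_differentiable)
qed

section \<open>Continuity of integrals depending on a parameter\<close>

text \<open>Bridge from the abstract product topology, in which smoothness is defined, to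
  \<open>continuous_on\<close>, in which the integrals are treated: continuity into a product is
  checked coordinatewise.\<close>

lemma continuous_on_powertop_compose:
  fixes h :: "(nat \<Rightarrow> real) \<Rightarrow> real" and Y :: "'b::topological_space \<Rightarrow> nat \<Rightarrow> real"
  assumes "continuous_map (powertop_real {..<n}) euclideanreal h"
    and "\<And>s. s \<in> S \<Longrightarrow> Y s \<in> Rn n" and "\<And>k. k < n \<Longrightarrow> continuous_on S (\<lambda>s. Y s k)"
  shows "continuous_on S (\<lambda>s. h (Y s))"
proof -
  have "continuous_map (top_of_set S) (powertop_real {..<n}) Y"
    using assms(2,3) by (force simp: continuous_map_componentwise PiE_iff)
  from continuous_map_compose[OF this assms(1)] show ?thesis
    by (simp add: o_def)
qed

text \<open>The parameter space is arbitrary because two are needed: \<open>X\<close> the identity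
  yields continuity of the integral, and \<open>X s = x(l := s)\<close> yields the hypotheses of the
  Leibniz rule.\<close>

lemma continuous_on_seg_integrand:
  fixes X :: "'b::topological_space \<Rightarrow> nat \<Rightarrow> real" and p q :: "real \<Rightarrow> real"
  assumes "continuous_map (powertop_real {..<n}) euclideanreal h" "i < n"
    and "continuous_on {0..1} p" "continuous_on {0..1} q"
    and "\<And>k. k \<le> n \<Longrightarrow> continuous_on UNIV (\<lambda>s. X s k)"
  shows "continuous_on (UNIV \<times> {0..1}) (\<lambda>(s, t). p t * h (seg_point n i (q t) (X s)))"
proof -
  have c: "continuous_on (UNIV \<times> {0..1}) (\<lambda>z::'b \<times> real. r (snd z))"
    if "continuous_on {0..1} r" for r :: "real \<Rightarrow> real"
    by (rule continuous_on_compose2[OF that]) (auto intro: continuous_on_snd continuous_on_id)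
  have d: "continuous_on (UNIV \<times> {0..1}) (\<lambda>z::'b \<times> real. X (fst z) k)" if "k \<le> n" for k
    by (rule continuous_on_compose2[OF assms(5)[OF that]]) (auto intro: continuous_on_fst continuous_on_id)
  have "continuous_on (UNIV \<times> {0..1}) (\<lambda>z::'b \<times> real. h (seg_point n i (q (snd z)) (X (fst z))))"
  proof (rule continuous_on_powertop_compose[OF assms(1)])
    fix k assume "k < n"
    then show "continuous_on (UNIV \<times> {0..1}) (\<lambda>z::'b \<times> real. seg_point n i (q (snd z)) (X (fst z)) k)"
      using assms(2)
      by (cases "k = i")
        (auto simp: seg_point_def intro!: continuous_on_add continuous_on_mult continuous_on_diff c d assms(4))
  qed (rule seg_point_Rn)
  with c[OF assms(3)] show ?thesis
    by (auto simp: case_prod_unfold intro: continuous_on_mult)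
qed

lemma continuous_map_seg_int:
  assumes "smooth_on_Rn n h" "i < n" "continuous_on {0..1} p" "continuous_on {0..1} q"
  shows "continuous_map (powertop_real {..<Suc n}) euclideanreal (seg_int n i p q h)"
proof -
  have "continuous_on (UNIV \<times> cbox 0 1) (\<lambda>(x, t). p t * h (seg_point n i (q t) x))"
    using continuous_on_seg_integrand[OF smooth_continuous[OF assms(1)] assms(2-4), of "\<lambda>x. x"]
    by (simp add: continuous_on_product_coordinates)
  from integral_continuous_on_param[OF this]
  have "continuous_on UNIV (seg_int n i p q h)"
    by (simp add: seg_int_def[abs_def])
  \<comment> \<open>The type class topology is the product over all indices, the given one only over
    \<open>{..<Suc n}\<close>. The inclusion is continuous because on the carrier every coordinate
    from \<open>Suc n\<close> on is constantly \<open>undefined\<close>.\<close>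
  moreover have "continuous_map (powertop_real {..<Suc n}) euclidean (\<lambda>x. x)"
    unfolding euclidean_product_topology[symmetric] continuous_map_componentwise_UNIV
  proof
    fix k
    show "continuous_map (powertop_real {..<Suc n}) euclideanreal (\<lambda>x. x k)"
    proof (cases "k < Suc n")
      case False
      have "continuous_map (powertop_real {..<Suc n}) euclideanreal (\<lambda>x. undefined)" by simp
      then show ?thesis
        by (rule continuous_map_eq) (use False in \<open>auto simp: PiE_iff extensional_def\<close>)
    qed (auto intro: continuous_map_product_projection)
  qed
  ultimately show ?thesis
    using continuous_map_compose[of "powertop_real {..<Suc n}" euclidean "\<lambda>x. x" euclidean
        "seg_int n i p q h"] by (simp add: o_def)
qed

section \<open>Partial derivatives and smoothness of the integrals\<close>

text \<open>Differentiation under the integral sign. The inner derivative \<open>r t\<close> depends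
  on \<open>t\<close> alone, so it is absorbed into the weight, while the path \<open>q\<close>
  stays the same.\<close>

lemma seg_int_has_derivative:
  assumes "smooth_on_Rn n h" "i < n" "j < n" "continuous_on {0..1} p" "continuous_on {0..1} q"
    and "continuous_on {0..1} r"
    and deriv: "\<And>t s. ((\<lambda>s. h (seg_point n i (q t) (x(l := s)))) has_real_derivative
      r t * partial j h (seg_point n i (q t) (x(l := s)))) (at s)"
  shows "((\<lambda>s. seg_int n i p q h (x(l := s))) has_real_derivative
    seg_int n i (\<lambda>t. p t * r t) q (partial j h) (x(l := s))) (at s)"
proof -
  have X: "continuous_on UNIV (\<lambda>s. (x(l := s)) k)" for k
    by (cases "k = l") auto
  note cont = continuous_on_seg_integrand[OF smooth_continuous assms(2), of _ _ q "\<lambda>s. x(l := s)",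
      OF _ _ assms(5) X]
  have "((\<lambda>s. integral (cbox 0 1) (\<lambda>t. p t * h (seg_point n i (q t) (x(l := s))))) has_real_derivative
    integral (cbox 0 1) (\<lambda>t. p t * r t * partial j h (seg_point n i (q t) (x(l := s))))) (at s within UNIV)"
  proof (rule leibniz_rule_field_derivative)
    show "((\<lambda>s. p t * h (seg_point n i (q t) (x(l := s)))) has_real_derivative
      p t * r t * partial j h (seg_point n i (q t) (x(l := s)))) (at s within UNIV)" for s t
      using DERIV_cmult[OF deriv, of "p t"] by (simp add: mult.assoc)
    show "(\<lambda>t. p t * h (seg_point n i (q t) (x(l := s)))) integrable_on cbox 0 1" for s
    proof (rule integrable_continuous)
      have "continuous_on {0..1} (\<lambda>t. case (s, t) of (s, t) \<Rightarrow> p t * h (seg_point n i (q t) (x(l := s))))"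
        by (rule continuous_on_compose2[OF cont[OF assms(1,4)]]) (auto intro: continuous_on_Pair)
      then show "continuous_on (cbox 0 1) (\<lambda>t. p t * h (seg_point n i (q t) (x(l := s))))"
        by simp
    qed
    show "continuous_on (UNIV \<times> cbox 0 1)
        (\<lambda>(s, t). p t * r t * partial j h (seg_point n i (q t) (x(l := s))))"
      using cont[OF smooth_partial[OF assms(1,3)], of "\<lambda>t. p t * r t"] assms(4,6)
      by (auto intro: continuous_on_mult)
  qed auto
  then show ?thesis by (simp add: seg_int_def)
qed

text \<open>Only one coordinate of \<open>seg_point\<close> varies with \<open>x l\<close>: the
  \<open>i\<close>-th if \<open>l\<close> is \<open>i\<close> or \<open>n\<close>, and otherwise the
  \<open>l\<close>-th. Hence the chain rule in one variable suffices.\<close>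

lemma seg_int_partials:
  assumes h: "smooth_on_Rn n h" and i: "i < n" and l: "l < Suc n"
    and p: "continuous_on {0..1} p" and q: "continuous_on {0..1} q"
  obtains p' j where "continuous_on {0..1} p'" "j < n"
    "\<And>x s. ((\<lambda>s. seg_int n i p q h (x(l := s))) has_real_derivative
      seg_int n i p' q (partial j h) (x(l := s))) (at s)"
proof -
  obtain r j where r: "continuous_on {0..1} r" and j: "j < n" and
    d: "\<And>t x s. ((\<lambda>s. h (seg_point n i (q t) (x(l := s)))) has_real_derivative
      r t * partial j h (seg_point n i (q t) (x(l := s)))) (at s)"
  proof (cases "l = i \<or> l = n")
    case False
    show ?thesis
    proof (rule that[of "\<lambda>t. 1" l])
      have "seg_point n i u (x(l := s)) = (seg_point n i u x)(l := s)" for u x s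
        using False l i by (auto simp: seg_point_def fun_eq_iff)
      then show "((\<lambda>s. h (seg_point n i (q t) (x(l := s)))) has_real_derivative
        1 * partial l h (seg_point n i (q t) (x(l := s)))) (at s)" for t x s
        using smooth_has_partial[OF h _ seg_point_Rn, of l] False l by simp
    qed (use False l in auto)
  next
    case True
    \<comment> \<open>The \<open>i\<close>-th coordinate is
      \<open>(1 - q t) * x i + q t * x n\<close>, which is affine in \<open>x l\<close>:
      \<open>r\<close> is the slope and \<open>c\<close> the remaining term.\<close>
    define r where "r t = (if l = i then 1 - q t else q t)" for t
    define c where "c t x = (if l = i then q t * x n else (1 - q t) * x i)" for t and x :: "nat \<Rightarrow> real"
    have eq: "seg_point n i (q t) (x(l := s)) = (seg_point n i 0 x)(i := c t x + r t * s)" for t x s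
      using True i by (auto simp: seg_point_def r_def c_def fun_eq_iff algebra_simps)
    show ?thesis
    proof (rule that[OF _ i, of r])
      show "continuous_on {0..1} r"
        unfolding r_def by (cases "l = i") (auto intro!: continuous_intros q)
      fix t x s
      have "((\<lambda>s. c t x + r t * s) has_real_derivative r t) (at s)"
        by (auto intro!: derivative_eq_intros)
      from DERIV_chain2[OF smooth_has_partial[OF h i seg_point_Rn] this]
      show "((\<lambda>s. h (seg_point n i (q t) (x(l := s)))) has_real_derivative
        r t * partial i h (seg_point n i (q t) (x(l := s)))) (at s)"
        by (simp add: eq mult.commute)
    qed
  qed
  show thesis
    by (rule that[of "\<lambda>t. p t * r t", OF _ j seg_int_has_derivative[OF h i j p q r d]])
      (auto intro: continuous_on_mult p r)
qed

text \<open>Reduces smoothness of these integrals to continuity and first partial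
  derivatives.\<close>

lemma foldr_partial_seg_int:
  assumes "smooth_on_Rn n h" "i < n" "continuous_on {0..1} p" "continuous_on {0..1} q"
    and "set is \<subseteq> {..<Suc n}"
  shows "\<exists>p' h'. continuous_on {0..1} p' \<and> smooth_on_Rn n h' \<and>
    foldr partial is (seg_int n i p q h) = seg_int n i p' q h'"
  using assms(5)
proof (induction "is")
  case Nil
  then show ?case using assms by auto
next
  case (Cons l "is")
  then obtain p' h' where IH: "continuous_on {0..1} p'" "smooth_on_Rn n h'"
    "foldr partial is (seg_int n i p q h) = seg_int n i p' q h'" by auto
  have "l < Suc n" using Cons.prems by simp
  then obtain p'' j where "continuous_on {0..1} p''" and j: "j < n" and
    d: "\<And>x s. ((\<lambda>s. seg_int n i p' q h' (x(l := s))) has_real_derivative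
      seg_int n i p'' q (partial j h') (x(l := s))) (at s)"
    using seg_int_partials[OF IH(2) assms(2) _ IH(1) assms(4)] by metis
  moreover have "partial l (seg_int n i p' q h') = seg_int n i p'' q (partial j h')"
  proof
    fix x
    show "partial l (seg_int n i p' q h') x = seg_int n i p'' q (partial j h') x"
      using DERIV_imp_deriv[OF d[of x "x l"]] by (simp add: partial_def)
  qed
  ultimately show ?case using IH(3) smooth_partial[OF IH(2) j] by auto
qed

lemma smooth_seg_int:
  assumes "smooth_on_Rn n h" "i < n" "continuous_on {0..1} p" "continuous_on {0..1} q"
  shows "smooth_on_Rn (Suc n) (seg_int n i p q h)"
  unfolding smooth_on_Rn_def
proof (intro allI impI)
  fix "is" assume "set is \<subseteq> {..<Suc n}"
  then obtain p' h' where p': "continuous_on {0..1} p'" "smooth_on_Rn n h'"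
    and eq: "foldr partial is (seg_int n i p q h) = seg_int n i p' q h'"
    using foldr_partial_seg_int[OF assms] by blast
  have "(\<lambda>t. seg_int n i p' q h' (x(l := t))) differentiable at (x l)" if "l < Suc n" for l x
    using seg_int_partials[OF p'(2) assms(2) that p'(1) assms(4)]
    by (metis real_differentiable_def)
  then show "continuous_map (powertop_real {..<Suc n}) euclideanreal (foldr partial is (seg_int n i p q h)) \<and>
    (\<forall>l<Suc n. \<forall>x\<in>Rn (Suc n).
      (\<lambda>t. foldr partial is (seg_int n i p q h) (x(l := t))) differentiable at (x l))"
    using continuous_map_seg_int[OF p'(2) assms(2) p'(1) assms(4)] by (simp only: eq) blast
qed

lemma Cinf_seg_int:
  assumes "smooth_on_Rn n h" "i < n" "continuous_on {0..1} p" "continuous_on {0..1} q"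
  shows "restrict (seg_int n i p q h) (Rn (Suc n)) \<in> Cinf (Suc n)"
proof -
  have "smooth_on_Rn (Suc n) (restrict (seg_int n i p q h) (Rn (Suc n)))"
    by (rule smooth_on_Rn_cong[OF _ smooth_seg_int[OF assms]]) simp
  then show ?thesis by (simp add: Cinf_def)
qed

section \<open>Hadamard's lemma in one coordinate\<close>

lemma seg_int_const: "seg_int n i (\<lambda>t. 1) (\<lambda>t. s) h x = h (seg_point n i s x)"
  by (simp add: seg_int_def)

text \<open>The fundamental theorem of calculus along the segment: \<open>h\<close> has derivative
  \<open>(x n - x i) * partial i h\<close> there, and the first factor, constant in
  \<open>t\<close>, leaves the integral.\<close>

lemma hadamard_coordinate:
  assumes h: "smooth_on_Rn n h" and i: "i < n"
  shows "h (seg_point n i 1 x) =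
    h (seg_point n i 0 x) + (x n - x i) * seg_int n i (\<lambda>t. 1) (\<lambda>t. t) (partial i h) x"
proof -
  have eq: "seg_point n i t x = (seg_point n i 0 x)(i := x i + t * (x n - x i))" for t
    using i by (auto simp: seg_point_def fun_eq_iff)
  have "((\<lambda>t. h (seg_point n i t x)) has_real_derivative
      (x n - x i) * partial i h (seg_point n i t x)) (at t)" for t
  proof -
    have "((\<lambda>t. x i + t * (x n - x i)) has_real_derivative x n - x i) (at t)"
      by (auto intro!: derivative_eq_intros)
    from DERIV_chain2[OF smooth_has_partial[OF h i seg_point_Rn[of n i 0 x]] this]
    show ?thesis by (simp add: mult.commute flip: eq)
  qed
  then have "((\<lambda>t. (x n - x i) * partial i h (seg_point n i t x)) has_integral
      h (seg_point n i 1 x) - h (seg_point n i 0 x)) {0..1}"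
    by (intro fundamental_theorem_of_calculus)
      (auto simp: has_real_derivative_iff_has_vector_derivative[symmetric]
        intro: has_field_derivative_at_within)
  from integral_unique[OF this] show ?thesis by (simp add: seg_int_def)
qed

section \<open>Hadamard's identity inside a smooth ring\<close>

context cinf_ring
begin

lemma ev_uminus:
  assumes "polyfun k f" "a \<in> {..<k} \<rightarrow>\<^sub>E A"
  shows "ev k (\<lambda>x. - f x) a = \<ominus>\<^bsub>U\<^esub> ev k f a"
proof -
  interpret cring U by (rule cring_underlying_ring)
  have "ev k (\<lambda>x. - f x) a \<oplus>\<^bsub>U\<^esub> ev k f a = \<zero>\<^bsub>U\<^esub>"
    using ev_add[OF polyfun_uminus[OF assms(1)] assms] ev_const[OF assms(2), of 0]
    by (simp add: U_simps(4))
  then show ?thesis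
    by (intro minus_equality[symmetric])
      (simp_all only: U_simps(1) ev_closed[OF polyfun_uminus] ev_closed assms)
qed

text \<open>At both endpoints each coordinate of the segment point is a projection of R^(n+1), so
  the axioms on composition and projections compute the value.\<close>

lemma Phi_seg_point:
  assumes "f \<in> Cinf n" "i < n" "s = 0 \<or> s = 1" "a \<in> {..<Suc n} \<rightarrow>\<^sub>E A"
  shows "\<Phi> (Suc n) (restrict (seg_int n i (\<lambda>t. 1) (\<lambda>t. s) f) (Rn (Suc n))) a =
    \<Phi> n f (\<lambda>k\<in>{..<n}. a (if k = i \<and> s = 1 then n else k))"
proof -
  define g :: "nat \<Rightarrow> (nat \<Rightarrow> real) \<Rightarrow> real"
    where "g k = (\<lambda>x\<in>Rn (Suc n). x (if k = i \<and> s = 1 then n else k))" for k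
  have f: "smooth_on_Rn n f" using assms(1) by (simp add: Cinf_def)
  have "\<Phi> (Suc n) (restrict (seg_int n i (\<lambda>t. 1) (\<lambda>t. s) f) (Rn (Suc n))) a =
    \<Phi> n f (\<lambda>k\<in>{..<n}. \<Phi> (Suc n) (g k) a)"
  proof (rule Phi_comp)
    show "g k \<in> Cinf (Suc n)" if "k < n" for k
      unfolding g_def using that by (intro polyfun_Cinf polyfun.coord) auto
    fix x assume "x \<in> Rn (Suc n)"
    then have "seg_point n i s x = (\<lambda>k\<in>{..<n}. g k x)"
      using assms(3) by (auto simp: seg_point_def g_def fun_eq_iff)
    then show "restrict (seg_int n i (\<lambda>t. 1) (\<lambda>t. s) f) (Rn (Suc n)) x = f (\<lambda>k\<in>{..<n}. g k x)"
      using \<open>x \<in> Rn (Suc n)\<close> by (simp add: seg_int_const)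
  qed (intro assms Cinf_seg_int f continuous_on_const)+
  also have "(\<lambda>k\<in>{..<n}. \<Phi> (Suc n) (g k) a) = (\<lambda>k\<in>{..<n}. a (if k = i \<and> s = 1 then n else k))"
    using assms(4) by (auto simp: g_def fun_eq_iff Phi_proj)
  finally show ?thesis .
qed

text \<open>\<open>b\<close> is the value of the Hadamard quotient at \<open>a\<close> extended by
  \<open>c\<close>. As the axioms on \<open>\<Phi>\<close> concern compositions and projections, the
  identity of functions is first written as a composition with a polynomial.\<close>

lemma Phi_change_coordinate:
  assumes f: "f \<in> Cinf n" and i: "i < n" and a: "a \<in> {..<n} \<rightarrow>\<^sub>E A" and c: "c \<in> A"
  obtains b where "b \<in> A" "\<Phi> n f (a(i := c)) = \<Phi> n f a \<oplus>\<^bsub>U\<^esub> (c \<ominus>\<^bsub>U\<^esub> a i) \<otimes>\<^bsub>U\<^esub> b"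
proof -
  let ?R = "\<lambda>F. restrict F (Rn (Suc n))"
  \<comment> \<open>The new value enters as one more argument at index \<open>n\<close>, in the role
    of \<open>x n\<close> in \<open>hadamard_coordinate\<close>.\<close>
  define \<alpha> where "\<alpha> = a(n := c)"
  have \<alpha>: "\<alpha> \<in> {..<Suc n} \<rightarrow>\<^sub>E A"
    using a c by (auto simp: \<alpha>_def PiE_iff extensional_def)
  have sf: "smooth_on_Rn n f" using f by (simp add: Cinf_def)
  define F where "F s = ?R (seg_int n i (\<lambda>t. 1) (\<lambda>t. s) f)" for s
  define g where "g = ?R (seg_int n i (\<lambda>t. 1) (\<lambda>t. t) (partial i f))"
  have F: "F s \<in> Cinf (Suc n)" for s
    unfolding F_def by (intro Cinf_seg_int sf i) auto
  have g: "g \<in> Cinf (Suc n)"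
    unfolding g_def by (intro Cinf_seg_int smooth_partial sf i) auto
  have F1: "\<Phi> (Suc n) (F 1) \<alpha> = \<Phi> n f (a(i := c))"
    unfolding F_def
  proof (subst Phi_seg_point[OF f i _ \<alpha>])
    show "\<Phi> n f (\<lambda>k\<in>{..<n}. \<alpha> (if k = i \<and> 1 = 1 then n else k)) = \<Phi> n f (a(i := c))"
      by (rule arg_cong[of _ _ "\<Phi> n f"])
        (use a i in \<open>auto simp: \<alpha>_def fun_eq_iff PiE_iff extensional_def\<close>)
  qed simp
  have F0: "\<Phi> (Suc n) (F 0) \<alpha> = \<Phi> n f a"
    unfolding F_def
  proof (subst Phi_seg_point[OF f i _ \<alpha>])
    show "\<Phi> n f (\<lambda>k\<in>{..<n}. \<alpha> (if k = i \<and> (0::real) = 1 then n else k)) = \<Phi> n f a"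
      by (rule arg_cong[of _ _ "\<Phi> n f"])
        (use a i in \<open>auto simp: \<alpha>_def fun_eq_iff PiE_iff extensional_def\<close>)
  qed simp
  \<comment> \<open>The shape of the right-hand side of \<open>hadamard_coordinate\<close>; its
    variables 0 to 3 receive the four functions in \<open>gs\<close>. The difference is written as a
    sum with a negative, the form that \<open>ev_add\<close> and \<open>ev_uminus\<close>
    evaluate.\<close>
  define P :: "(nat \<Rightarrow> real) \<Rightarrow> real" where "P = (\<lambda>v. v 0 + (v 1 + - v 2) * v 3)"
  have P: "polyfun 4 P"
    unfolding P_def by (intro polyfun.intros polyfun_uminus) auto
  define gs where "gs = [F 0, ?R (\<lambda>x. x n), ?R (\<lambda>x. x i), g]"
  have "\<Phi> (Suc n) (F 1) \<alpha> = \<Phi> 4 (restrict P (Rn 4)) (\<lambda>k\<in>{..<4}. \<Phi> (Suc n) (gs ! k) \<alpha>)"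
  proof (rule Phi_comp[OF polyfun_Cinf[OF P] _ F _ \<alpha>])
    have "\<forall>G\<in>set gs. G \<in> Cinf (Suc n)"
      using i by (auto simp: gs_def F g intro!: polyfun_Cinf polyfun.coord)
    then show "gs ! k \<in> Cinf (Suc n)" if "k < 4" for k
      using that nth_mem[of k gs] by (auto simp: gs_def simp del: nth_mem)
    fix x assume "x \<in> Rn (Suc n)"
    then show "F 1 x = restrict P (Rn 4) (\<lambda>k\<in>{..<4}. (gs ! k) x)"
      using hadamard_coordinate[OF sf i, of x] by (simp add: P_def gs_def F_def g_def seg_int_const)
  qed
  also have "(\<lambda>k\<in>{..<4}. \<Phi> (Suc n) (gs ! k) \<alpha>) = tup [\<Phi> n f a, c, a i, \<Phi> (Suc n) g \<alpha>]"
    using F0 i \<alpha> by (auto simp: tup_def gs_def fun_eq_iff Phi_proj less_Suc_eq numeral_eq_Suc \<alpha>_def)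
  also have "\<Phi> 4 (restrict P (Rn 4)) \<dots> = ev 4 P (tup [\<Phi> n f a, c, a i, \<Phi> (Suc n) g \<alpha>])"
    by (simp add: ev_def)
  also have "\<dots> = \<Phi> n f a \<oplus>\<^bsub>U\<^esub> (c \<ominus>\<^bsub>U\<^esub> a i) \<otimes>\<^bsub>U\<^esub> \<Phi> (Suc n) g \<alpha>"
  proof -
    have "tup [\<Phi> n f a, c, a i, \<Phi> (Suc n) g \<alpha>] \<in> {..<4} \<rightarrow>\<^sub>E A"
      using Phi_closed[OF f] Phi_closed[OF g] a \<alpha> i c by (intro tup_PiE) auto
    then show ?thesis
      by (simp add: P_def ev_simps ev_uminus polyfun_uminus a_minus_def del: add_uminus_conv_diff)
  qed
  finally have "\<Phi> n f (a(i := c)) = \<Phi> n f a \<oplus>\<^bsub>U\<^esub> (c \<ominus>\<^bsub>U\<^esub> a i) \<otimes>\<^bsub>U\<^esub> \<Phi> (Suc n) g \<alpha>"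
    by (simp only: F1)
  then show thesis using that Phi_closed[OF g] \<alpha> by blast
qed

section \<open>From congruences to ideals\<close>

lemma Cong_subset: "R \<in> Cong A \<Phi> \<Longrightarrow> R \<subseteq> A \<times> A"
  by (auto simp: Cong_def cinf_congruence_def equiv_def refl_on_def)

lemma Cong_refl: "R \<in> Cong A \<Phi> \<Longrightarrow> x \<in> A \<Longrightarrow> (x, x) \<in> R"
  by (auto simp: Cong_def cinf_congruence_def equiv_def refl_on_def)

lemma Cong_polyfun:
  assumes R: "R \<in> Cong A \<Phi>" and P: "polyfun 2 P" and "(x, y) \<in> R" "(x', y') \<in> R"
  shows "(ev 2 P (tup [x, x']), ev 2 P (tup [y, y'])) \<in> R"
proof -
  have "tup [x, x'] \<in> {..<2} \<rightarrow>\<^sub>E A" "tup [y, y'] \<in> {..<2} \<rightarrow>\<^sub>E A"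
    using assms Cong_subset[OF R] by (auto intro!: tup_PiE)
  with R polyfun_Cinf[OF P] assms(3,4) show ?thesis
    by (auto simp: Cong_def cinf_congruence_def ev_def tup_nth less_2_cases_iff)
qed

lemma Cong_add:
  "R \<in> Cong A \<Phi> \<Longrightarrow> (x, y) \<in> R \<Longrightarrow> (x', y') \<in> R \<Longrightarrow> (x \<oplus>\<^bsub>U\<^esub> x', y \<oplus>\<^bsub>U\<^esub> y') \<in> R"
  unfolding U_simps by (rule Cong_polyfun) (auto intro!: polyfun.add polyfun.coord)

lemma Cong_mult:
  "R \<in> Cong A \<Phi> \<Longrightarrow> (x, y) \<in> R \<Longrightarrow> (x', y') \<in> R \<Longrightarrow> (x \<otimes>\<^bsub>U\<^esub> x', y \<otimes>\<^bsub>U\<^esub> y') \<in> R"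
  unfolding U_simps by (rule Cong_polyfun) (auto intro!: polyfun.mult polyfun.coord)

text \<open>Adding the reflexive pair \<open>(y, y)\<close>, or the one of the negative of
  \<open>y\<close>, passes from one side to the other. Thus a congruence is determined by its class
  of zero.\<close>

lemma Cong_diff_iff:
  assumes R: "R \<in> Cong A \<Phi>" and x: "x \<in> A" and y: "y \<in> A"
  shows "(x \<ominus>\<^bsub>U\<^esub> y, \<zero>\<^bsub>U\<^esub>) \<in> R \<longleftrightarrow> (x, y) \<in> R"
proof -
  interpret cring U by (rule cring_underlying_ring)
  note [simp] = U_simps(1)
  have my: "\<ominus>\<^bsub>U\<^esub> y \<in> A" using a_inv_closed[of y] y by simp
  have 1: "x \<ominus>\<^bsub>U\<^esub> y \<oplus>\<^bsub>U\<^esub> y = x"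
    using x y my by (simp add: a_minus_def a_assoc l_neg)
  show ?thesis
  proof
    assume "(x \<ominus>\<^bsub>U\<^esub> y, \<zero>\<^bsub>U\<^esub>) \<in> R"
    from Cong_add[OF R this Cong_refl[OF R y]] show "(x, y) \<in> R"
      using y 1 by simp
  next
    assume "(x, y) \<in> R"
    from Cong_add[OF R this Cong_refl[OF R my]] show "(x \<ominus>\<^bsub>U\<^esub> y, \<zero>\<^bsub>U\<^esub>) \<in> R"
      using y by (simp add: a_minus_def r_neg)
  qed
qed

lemma phi_psi: "R \<in> Cong A \<Phi> \<Longrightarrow> phi A \<Phi> (psi A \<Phi> R) = R"
proof -
  assume R: "R \<in> Cong A \<Phi>"
  interpret cring U by (rule cring_underlying_ring)
  have "x \<ominus>\<^bsub>U\<^esub> y \<in> A" if "x \<in> A" "y \<in> A" for x y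
    using minus_closed that by (simp add: U_simps(1))
  then show ?thesis
    using Cong_diff_iff[OF R] Cong_subset[OF R] by (auto simp: phi_def psi_def)
qed

lemma psi_phi: "I \<in> Ideals A \<Phi> \<Longrightarrow> psi A \<Phi> (phi A \<Phi> I) = I"
proof -
  assume I: "I \<in> Ideals A \<Phi>"
  then interpret ideal I U by (simp add: Ideals_def)
  have "x \<ominus>\<^bsub>U\<^esub> \<zero>\<^bsub>U\<^esub> = x" if "x \<in> A" for x
    using that by (simp add: a_minus_def U_simps(1))
  then show ?thesis
    using a_subset by (auto simp: phi_def psi_def U_simps(1))
qed

lemma psi_in_Ideals:
  assumes R: "R \<in> Cong A \<Phi>"
  shows "psi A \<Phi> R \<in> Ideals A \<Phi>"
proof -
  interpret cring U by (rule cring_underlying_ring)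
  note [simp] = U_simps(1)
  have zero: "(\<zero>\<^bsub>U\<^esub>, \<zero>\<^bsub>U\<^esub>) \<in> R" using Cong_refl[OF R] by simp
  have mult: "y \<otimes>\<^bsub>U\<^esub> x \<in> psi A \<Phi> R" if "x \<in> psi A \<Phi> R" "y \<in> A" for x y
    using Cong_mult[OF R Cong_refl[OF R that(2)], of x "\<zero>\<^bsub>U\<^esub>"] that by (simp add: psi_def)
  have "ideal (psi A \<Phi> R) U"
  proof (rule idealI)
    show "subgroup (psi A \<Phi> R) (add_monoid U)"
    proof (rule add.subgroupI)
      show "psi A \<Phi> R \<subseteq> carrier U" by (auto simp: psi_def)
      show "psi A \<Phi> R \<noteq> {}" using zero by (auto simp: psi_def intro!: exI[of _ "\<zero>\<^bsub>U\<^esub>"])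
      show "\<ominus>\<^bsub>U\<^esub> x \<in> psi A \<Phi> R" if "x \<in> psi A \<Phi> R" for x
      proof -
        have "x \<in> A" using that by (simp add: psi_def)
        \<comment> \<open>Closure under negatives comes from absorption, by -x = (-1) * x.\<close>
        then have "\<ominus>\<^bsub>U\<^esub> x = \<ominus>\<^bsub>U\<^esub> \<one>\<^bsub>U\<^esub> \<otimes>\<^bsub>U\<^esub> x" by (simp add: l_minus)
        then show ?thesis using mult[OF that, of "\<ominus>\<^bsub>U\<^esub> \<one>\<^bsub>U\<^esub>"] a_inv_closed[OF one_closed] by simp
      qed
      show "x \<oplus>\<^bsub>U\<^esub> y \<in> psi A \<Phi> R" if "x \<in> psi A \<Phi> R" "y \<in> psi A \<Phi> R" for x y
        using Cong_add[OF R, of x "\<zero>\<^bsub>U\<^esub>" y "\<zero>\<^bsub>U\<^esub>"] that by (simp add: psi_def)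
    qed
    show "y \<otimes>\<^bsub>U\<^esub> x \<in> psi A \<Phi> R" "x \<otimes>\<^bsub>U\<^esub> y \<in> psi A \<Phi> R"
      if "x \<in> psi A \<Phi> R" "y \<in> carrier U" for x y
    proof -
      show "y \<otimes>\<^bsub>U\<^esub> x \<in> psi A \<Phi> R" using mult that by simp
      moreover have "x \<otimes>\<^bsub>U\<^esub> y = y \<otimes>\<^bsub>U\<^esub> x" using that by (intro m_comm) (auto simp: psi_def)
      ultimately show "x \<otimes>\<^bsub>U\<^esub> y \<in> psi A \<Phi> R" by simp
    qed
  qed (rule ring_axioms)
  then show ?thesis by (simp add: Ideals_def)
qed

section \<open>From ideals to congruences\<close>

lemma phi_iff: "(x, y) \<in> phi A \<Phi> I \<longleftrightarrow> x \<in> A \<and> y \<in> A \<and> x \<ominus>\<^bsub>U\<^esub> y \<in> I"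
  by (auto simp: phi_def)

lemma equiv_phi:
  assumes "I \<in> Ideals A \<Phi>"
  shows "equiv A (phi A \<Phi> I)"
proof -
  interpret R: cring U by (rule cring_underlying_ring)
  interpret ideal I U using assms by (simp add: Ideals_def)
  note [simp] = U_simps(1)
  show ?thesis
  proof (rule equivI)
    show "phi A \<Phi> I \<subseteq> A \<times> A" by (auto simp: phi_iff)
    show "refl_on A (phi A \<Phi> I)"
      using additive_subgroup.zero_closed[OF is_additive_subgroup]
      by (auto simp: refl_on_def phi_iff a_minus_def R.r_neg)
    show "sym (phi A \<Phi> I)"
    proof (rule symI)
      fix x y assume xy: "(x, y) \<in> phi A \<Phi> I"
      then have "\<ominus>\<^bsub>U\<^esub> (x \<ominus>\<^bsub>U\<^esub> y) \<in> I" by (auto simp: phi_iff intro: a_inv_closed)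
      moreover have "\<ominus>\<^bsub>U\<^esub> (x \<ominus>\<^bsub>U\<^esub> y) = y \<ominus>\<^bsub>U\<^esub> x"
        using xy R.a_inv_closed[of x] R.a_inv_closed[of y]
          by (simp add: phi_iff a_minus_def R.minus_add R.a_comm)
      ultimately show "(y, x) \<in> phi A \<Phi> I" using xy by (simp add: phi_iff)
    qed
    show "trans (phi A \<Phi> I)"
    proof (rule transI)
      fix x y z assume xyz: "(x, y) \<in> phi A \<Phi> I" "(y, z) \<in> phi A \<Phi> I"
      have "(x \<ominus>\<^bsub>U\<^esub> y) \<oplus>\<^bsub>U\<^esub> (y \<ominus>\<^bsub>U\<^esub> z) = x \<ominus>\<^bsub>U\<^esub> z"
        using xyz R.a_inv_closed[of y] R.a_inv_closed[of z]
        by (simp add: phi_iff a_minus_def R.a_assoc R.r_neg1)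
      moreover have "(x \<ominus>\<^bsub>U\<^esub> y) \<oplus>\<^bsub>U\<^esub> (y \<ominus>\<^bsub>U\<^esub> z) \<in> I"
        using xyz by (auto simp: phi_iff intro: a_closed)
      ultimately show "(x, z) \<in> phi A \<Phi> I" using xyz by (simp add: phi_iff)
    qed
  qed
qed

lemma phi_in_Cong:
  assumes I: "I \<in> Ideals A \<Phi>"
  shows "phi A \<Phi> I \<in> Cong A \<Phi>"
proof -
  interpret R: cring U by (rule cring_underlying_ring)
  interpret ideal I U using I by (simp add: Ideals_def)
  note [simp] = U_simps(1)
  note equiv = equiv_phi[OF I]
  \<comment> \<open>The two values differ by a multiple of \<open>c - z i\<close>; the ideal absorbs
    the cofactor, of which only membership in \<open>A\<close> is known.\<close>
  have step: "(\<Phi> n f (z(i := c)), \<Phi> n f z) \<in> phi A \<Phi> I"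
    if f: "f \<in> Cinf n" and i: "i < n" and z: "z \<in> {..<n} \<rightarrow>\<^sub>E A" and c: "(c, z i) \<in> phi A \<Phi> I"
    for n f i z c
  proof -
    have cI: "c \<in> A" "c \<ominus>\<^bsub>U\<^esub> z i \<in> I" using c by (auto simp: phi_iff)
    obtain b where b: "b \<in> A" "\<Phi> n f (z(i := c)) = \<Phi> n f z \<oplus>\<^bsub>U\<^esub> (c \<ominus>\<^bsub>U\<^esub> z i) \<otimes>\<^bsub>U\<^esub> b"
      using Phi_change_coordinate[OF f i z cI(1)] .
    have d: "(c \<ominus>\<^bsub>U\<^esub> z i) \<otimes>\<^bsub>U\<^esub> b \<in> I" using cI b by (intro I_r_closed) auto
    then have dA: "(c \<ominus>\<^bsub>U\<^esub> z i) \<otimes>\<^bsub>U\<^esub> b \<in> A" using a_subset by auto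
    have fz: "\<Phi> n f z \<in> A" using Phi_closed[OF f] z by blast
    define d where "d = (c \<ominus>\<^bsub>U\<^esub> z i) \<otimes>\<^bsub>U\<^esub> b"
    have "\<Phi> n f z \<oplus>\<^bsub>U\<^esub> d \<ominus>\<^bsub>U\<^esub> \<Phi> n f z = d"
      using fz dA R.a_inv_closed[of "\<Phi> n f z"] unfolding d_def[symmetric]
      by (simp add: a_minus_def R.a_comm[of _ d] R.a_assoc R.r_neg)
    then show ?thesis using d dA fz b(2) by (simp add: phi_iff d_def)
  qed
  have "(\<Phi> n f x, \<Phi> n f y) \<in> phi A \<Phi> I"
    if f: "f \<in> Cinf n" and x: "x \<in> {..<n} \<rightarrow>\<^sub>E A" and y: "y \<in> {..<n} \<rightarrow>\<^sub>E A"
      and xy: "\<And>i. i < n \<Longrightarrow> (x i, y i) \<in> phi A \<Phi> I" for n f x y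
  proof -
    \<comment> \<open>Hybrid tuples leading from \<open>y\<close> at \<open>m = 0\<close> to
      \<open>x\<close> at \<open>m = n\<close>, one coordinate per step. At indices from
      \<open>n\<close> on both tuples are \<open>undefined\<close>, so the hybrids stay in the power
      of \<open>A\<close>.\<close>
    let ?w = "\<lambda>m k. if k < m then x k else y k"
    have "(\<Phi> n f (?w m), \<Phi> n f y) \<in> phi A \<Phi> I" if "m \<le> n" for m
      using that
    proof (induction m)
      case 0
      have "\<Phi> n f y \<in> A" using Phi_closed[OF f] y by blast
      then show ?case using equiv by (simp add: equiv_def refl_on_def)
    next
      case (Suc m)
      have "?w (Suc m) = (?w m)(m := x m)" by (auto simp: fun_eq_iff)
      moreover have "?w m \<in> {..<n} \<rightarrow>\<^sub>E A"
        using x y Suc.prems by (auto simp: PiE_iff extensional_def)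
      ultimately have "(\<Phi> n f (?w (Suc m)), \<Phi> n f (?w m)) \<in> phi A \<Phi> I"
        using step[OF f, of m "?w m" "x m"] xy[of m] Suc.prems by simp
      with Suc show ?case using equiv by (auto simp: equiv_def dest: transD)
    qed
    moreover have "?w n = x"
      using x y by (auto simp: fun_eq_iff PiE_iff extensional_def)
    ultimately show ?thesis by (metis order_refl)
  qed
  then show ?thesis using equiv by (simp add: Cong_def cinf_congruence_def)
qed

end

theorem proposition13:
  fixes A :: "'a set" and \<Phi> :: "'a cinf_interp"
  assumes "cinf_ring A \<Phi>"
    and "finitely_generated A \<Phi>"
  shows "bij_betw (psi A \<Phi>) (Cong A \<Phi>) (Ideals A \<Phi>) \<and>
    phi A \<Phi> \<in> Ideals A \<Phi> \<rightarrow> Cong A \<Phi> \<and>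
    (\<forall>R \<in> Cong A \<Phi>. phi A \<Phi> (psi A \<Phi> R) = R) \<and>
    (\<forall>I \<in> Ideals A \<Phi>. psi A \<Phi> (phi A \<Phi> I) = I)"
proof -
  interpret cinf_ring A \<Phi> by (rule assms(1))
  have "bij_betw (psi A \<Phi>) (Cong A \<Phi>) (Ideals A \<Phi>)"
    by (rule bij_betw_byWitness[where f' = "phi A \<Phi>"])
      (auto simp: phi_psi psi_phi psi_in_Ideals phi_in_Cong)
  then show ?thesis by (auto simp: phi_psi psi_phi phi_in_Cong)
qed

end
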